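(* Define two sequences by $A_0=1$, $A_1=3$, $B_0=0$, $B_1=1$ and $A_{k+1}=4A_k-A_{k-1}$, $B_{k+1}=4B_k-B_{k-1}$ for $k\ge 1$. Then for all integers $k\ge 1$ and $n\ge 1$, $$\sqrt{(A_k n+1)^2+2(2B_k n+1)}=\left[A_k n+1;\ \overline{\underbrace{1,2,\,1,2,\dots,1,2}_{(1,2)\text{ repeated }k\text{ times}},\ A_k n+1,\ \underbrace{2,1,\,2,1,\dots,2,1}_{(2,1)\text{ repeated }k\text{ times}},\ 2(A_k n+1)}\right].$$
   Context: $[a_0;\overline{a_1,\dots,a_\ell}]$ denotes the value of the infinite simple continued fraction $a_0+\cfrac{1}{a_1+\cfrac{1}{a_2+\dotsb}}$ with first partial quotient $a_0$, after which the block $a_1,\dots,a_\ell$ of positive integers is repeated indefinitely. *)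

theory Defs
  imports Complex_Main
begin

text \<open>
  The finite continued fraction \<open>a 0 + 1 / (a 1 + 1 / (\<dots> + 1 / a m))\<close>.
\<close>

fun cfrac_convergent :: "(nat \<Rightarrow> int) \<Rightarrow> nat \<Rightarrow> real" where
  "cfrac_convergent a 0 = of_int (a 0)"
| "cfrac_convergent a (Suc m) = of_int (a 0) + 1 / cfrac_convergent (\<lambda>i. a (Suc i)) m"

text \<open>
  \<open>has_cfrac_value a x\<close>: the partial quotients \<open>a\<close> form an infinite simple continued fraction
  and its value is \<open>x\<close>. As with \<open>sums\<close>, a relation is used rather than a function built on
  \<open>lim\<close>, so that convergence is part of the claim.
\<close>

definition has_cfrac_value :: "(nat \<Rightarrow> int) \<Rightarrow> real \<Rightarrow> bool" where
  "has_cfrac_value a x \<longleftrightarrow> (\<forall>i\<ge>1. a i > 0) \<and> cfrac_convergent a \<longlonglongrightarrow> x"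

text \<open>
  The partial quotients of \<open>[a0; xs, xs, xs, \<dots>]\<close>, for a nonempty block \<open>xs\<close>.
\<close>

definition periodic_quotients :: "int \<Rightarrow> int list \<Rightarrow> nat \<Rightarrow> int" where
  "periodic_quotients a0 xs i = (case i of 0 \<Rightarrow> a0 | Suc j \<Rightarrow> xs ! (j mod length xs))"

fun seqA :: "nat \<Rightarrow> int" where
  "seqA 0 = 1"
| "seqA (Suc 0) = 3"
| "seqA (Suc (Suc k)) = 4 * seqA (Suc k) - seqA k"

fun seqB :: "nat \<Rightarrow> int" where
  "seqB 0 = 0"
| "seqB (Suc 0) = 1"
| "seqB (Suc (Suc k)) = 4 * seqB (Suc k) - seqB k"

end

theory Submission imports Defs begin

text \<open>
  Write \<open>a = A\<^sub>k n + 1\<close> and let \<open>x\<close> be the square root. Prepending a word of partial quotients to a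
  complete quotient \<open>z\<close> is a Moebius transformation of \<open>z\<close>, whose matrix is the product of the
  matrices of the letters. The word \<open>1,2\<close> has the matrix \<open>((3, 1), (2, 1))\<close>, of determinant \<open>1\<close> and
  trace \<open>4\<close>, so its powers satisfy the recurrence of \<open>A\<close> and \<open>B\<close>: the \<open>k\<close>-th power is
  \<open>((A\<^sub>k, B\<^sub>k), (2 B\<^sub>k, A\<^sub>k - 2 B\<^sub>k))\<close>, and the reversed word \<open>2,1\<close> yields the transpose
  (\<open>prepend_power_12\<close>, \<open>prepend_power_21\<close>).

  The complete quotient after \<open>a\<close> must be \<open>y = 1 / (x - a)\<close>. Prepending the final letter \<open>2 a\<close> to \<open>y\<close>
  gives \<open>x + a\<close>, and prepending the rest of the period to \<open>x + a\<close> leads back to \<open>y\<close>; this identity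
  combines the quadratic equation of \<open>x + a\<close>, the choice of \<open>a\<close> and the fact that the matrix power has
  determinant \<open>1\<close> (\<open>period_fixed_point_identity\<close>). Hence
  \<open>y\<close> is a positive fixed point of its period, which determines the value of the continued fraction
  (\<open>has_cfrac_value_periodic\<close>), because a convergent of index \<open>m\<close> differs by at most \<open>2 ^ (- m)\<close> from
  a number whose complete quotients are positive (\<open>cfrac_convergent_error\<close>).
\<close>

section \<open>Convergence from complete quotients\<close>

lemma cfrac_convergent_ge:
  assumes "\<And>i. i \<ge> 1 \<Longrightarrow> a i > 0"
  shows "cfrac_convergent a m \<ge> of_int (a 0)"
  using assms
proof (induction m arbitrary: a)
  case 0
  then show ?case by simp
next
  case (Suc m)
  have "cfrac_convergent (\<lambda>i. a (Suc i)) m \<ge> of_int (a (Suc 0))"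
    using Suc.IH[of "\<lambda>i. a (Suc i)"] Suc.prems by simp
  moreover have "real_of_int (a (Suc 0)) > 0"
    using Suc.prems by simp
  ultimately show ?case by simp
qed

text \<open>
  Since \<open>1 / c - 1 / p = (p - c) / (c * p)\<close>, prepending a partial quotient divides the error by the
  product of the approximate quotient \<open>c\<close> and the exact quotient \<open>p\<close>. Each factor is only known to be at least \<open>1\<close>, but two
  consecutive ones have a product of at least \<open>2\<close>, since \<open>x i * x (i + 1) = a i * x (i + 1) + 1\<close>.
  Therefore the induction goes in steps of two, each of which gains a factor \<open>4\<close>.
\<close>

lemma cfrac_convergent_error:
  fixes a :: "nat \<Rightarrow> int" and x :: "nat \<Rightarrow> real"
  assumes "\<And>i. i \<ge> 1 \<Longrightarrow> a i > 0"
    and "\<And>i. i \<ge> 1 \<Longrightarrow> x i > 0"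
    and "\<And>i. x i = of_int (a i) + 1 / x (Suc i)"
  shows "\<bar>cfrac_convergent a m - x 0\<bar> \<le> (1 / 2) ^ m"
  using assms
proof (induction m arbitrary: a x rule: induct_nat_012)
  case 0
  have "x 1 \<ge> 1"
  proof -
    have "real_of_int (a 1) \<ge> 1" using "0.prems"(1)[of 1] by simp
    moreover have "1 / x (Suc 1) > 0" using "0.prems"(2)[of 2] by (simp add: numeral_2_eq_2)
    ultimately show ?thesis using "0.prems"(3)[of 1] by linarith
  qed
  moreover have "x 0 = of_int (a 0) + 1 / x 1"
    using "0.prems"(3)[of 0] by simp
  ultimately show ?case by simp
next
  case 1
  define p q where "p = x 1" and "q = x 2"
  have a1: "real_of_int (a 1) \<ge> 1" using "1.prems"(1)[of 1] by simp
  have q: "q \<ge> 1"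
  proof -
    have "real_of_int (a 2) \<ge> 1" using "1.prems"(1)[of 2] by simp
    moreover have "1 / x (Suc 2) > 0" using "1.prems"(2)[of "Suc 2"] by simp
    ultimately show ?thesis using "1.prems"(3)[of 2] unfolding q_def by linarith
  qed
  have p: "p = of_int (a 1) + 1 / q"
    using "1.prems"(3)[of 1] by (simp add: p_def q_def numeral_2_eq_2)
  have "p > 0" using p a1 q by (simp add: add_pos_pos)
  have "cfrac_convergent a (Suc 0) - x 0 = 1 / of_int (a 1) - 1 / p"
    using "1.prems"(3)[of 0] by (simp add: p_def)
  also have "\<dots> = (p - of_int (a 1)) / (of_int (a 1) * p)"
    using a1 \<open>p > 0\<close> by (simp add: field_simps)
  also have "\<dots> = 1 / (of_int (a 1) * (p * q))"
    using p q by simp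
  finally have e: "cfrac_convergent a (Suc 0) - x 0 = 1 / (of_int (a 1) * (p * q))" .
  have "p * q = of_int (a 1) * q + 1" using p q by (simp add: field_simps)
  moreover have "1 * 1 \<le> of_int (a 1) * q" using a1 q by (intro mult_mono) auto
  ultimately have "p * q \<ge> 2" by simp
  then have "1 * 2 \<le> of_int (a 1) * (p * q)" using a1 by (intro mult_mono) auto
  then show ?case unfolding e by (simp add: divide_simps)
next
  case (ge2 m)
  define b where "b = (\<lambda>i. a (Suc (Suc i)))"
  define p q d where "p = x 1" and "q = x 2" and "d = cfrac_convergent b m"
  define c where "c = real_of_int (a 1) + 1 / d"
  have a1: "real_of_int (a 1) \<ge> 1" using ge2.prems(1)[of 1] by simp
  have a2: "real_of_int (a 2) \<ge> 1" using ge2.prems(1)[of 2] by simp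
  have q: "q \<ge> 1"
  proof -
    have "1 / x (Suc 2) > 0" using ge2.prems(2)[of "Suc 2"] by simp
    then show ?thesis using ge2.prems(3)[of 2] a2 unfolding q_def by linarith
  qed
  have d: "d \<ge> 1"
    using cfrac_convergent_ge[of b m] ge2.prems(1) a2
    by (simp add: b_def d_def numeral_2_eq_2)
  have p: "p = of_int (a 1) + 1 / q"
    using ge2.prems(3)[of 1] by (simp add: p_def q_def numeral_2_eq_2)
  have pos: "p > 0" "c > 0" using p a1 q d by (simp_all add: c_def add_pos_pos)
  have "1 * 1 \<le> of_int (a 1) * q" "1 * 1 \<le> of_int (a 1) * d"
    using a1 q d by (intro mult_mono; simp)+
  moreover have pq: "p * q = of_int (a 1) * q + 1" and cd: "c * d = of_int (a 1) * d + 1"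
    using p q d by (simp_all add: c_def field_simps)
  ultimately have prod: "p * q \<ge> 2" "c * d \<ge> 2" by simp_all
  have "cfrac_convergent a (Suc (Suc m)) - x 0 = 1 / c - 1 / p"
    using ge2.prems(3)[of 0] by (simp add: p_def c_def d_def b_def)
  also have "\<dots> = (p - c) / (c * p)"
    using pos by (simp add: field_simps)
  also have "p - c = (d - q) / (d * q)"
    using p q d by (simp add: c_def field_simps)
  finally have e: "cfrac_convergent a (Suc (Suc m)) - x 0 = (d - q) / ((c * d) * (p * q))"
    by (simp add: mult_ac)
  have "\<bar>cfrac_convergent b m - x (Suc (Suc 0))\<bar> \<le> (1 / 2) ^ m"
  proof (rule ge2.IH(1))
    show "b i > 0" "x (Suc (Suc i)) > 0" for i
      using ge2.prems(1,2)[of "Suc (Suc i)"] by (simp_all add: b_def)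
    show "x (Suc (Suc i)) = of_int (b i) + 1 / x (Suc (Suc (Suc i)))" for i
      unfolding b_def by (rule ge2.prems(3))
  qed
  then have IH: "\<bar>d - q\<bar> \<le> (1 / 2) ^ m" by (simp add: d_def q_def numeral_2_eq_2)
  have "2 * 2 \<le> (c * d) * (p * q)" using prod by (intro mult_mono) auto
  then have "\<bar>d - q\<bar> / ((c * d) * (p * q)) \<le> (1 / 2) ^ m / 4"
    using IH by (intro frac_le) auto
  moreover have "\<bar>(c * d) * (p * q)\<bar> = (c * d) * (p * q)"
    using \<open>2 * 2 \<le> (c * d) * (p * q)\<close> by (intro abs_of_nonneg) linarith
  ultimately show ?case unfolding e by (simp add: abs_divide)
qed

lemma has_cfrac_value_complete_quotients:
  assumes "\<And>i. i \<ge> 1 \<Longrightarrow> a i > 0"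
    and "\<And>i. i \<ge> 1 \<Longrightarrow> x i > 0"
    and "\<And>i. x i = of_int (a i) + 1 / x (Suc i)"
  shows "has_cfrac_value a (x 0)"
proof -
  have "(\<lambda>m. cfrac_convergent a m - x 0) \<longlonglongrightarrow> 0"
  proof (rule tendsto_0_le[where K = 1])
    show "\<forall>\<^sub>F m in sequentially.
        norm (cfrac_convergent a m - x 0) \<le> norm ((1 / 2 :: real) ^ m) * 1"
      using cfrac_convergent_error[of a x, OF assms] by simp
    show "(\<lambda>m. (1 / 2 :: real) ^ m) \<longlonglongrightarrow> 0"
      by (simp add: LIMSEQ_power_zero)
  qed
  then show ?thesis
    using assms(1) by (simp add: has_cfrac_value_def LIM_zero_iff)
qed

section \<open>Periodic continued fractions\<close>

fun prepend :: "int list \<Rightarrow> real \<Rightarrow> real" where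
  "prepend [] z = z"
| "prepend (a # as) z = of_int a + 1 / prepend as z"

lemma prepend_append: "prepend (as @ bs) z = prepend as (prepend bs z)"
  by (induction as) auto

lemma prepend_pos:
  assumes "\<forall>a\<in>set as. a > 0" and "z > 0"
  shows "prepend as z > 0"
  using assms by (induction as) (auto intro!: add_pos_pos)

text \<open>
  The complete quotients of the periodic continued fraction arise from \<open>y\<close> by prepending the
  remainder of the current period; the fixed point equation makes them fit together where one
  period ends and the next begins.
\<close>

lemma has_cfrac_value_periodic:
  assumes "xs \<noteq> []" and pos: "\<forall>a\<in>set xs. a > 0" and "y > 0" and fixp: "prepend xs y = y"
  shows "has_cfrac_value (periodic_quotients a0 xs) (of_int a0 + 1 / y)"
proof -
  define l where "l = length xs"
  have "l > 0" using assms(1) by (simp add: l_def)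
  define x where
    "x i = (case i of 0 \<Rightarrow> of_int a0 + 1 / y | Suc j \<Rightarrow> prepend (drop (j mod l) xs) y)" for i
  have "has_cfrac_value (periodic_quotients a0 xs) (x 0)"
  proof (rule has_cfrac_value_complete_quotients)
    fix i :: nat assume "i \<ge> 1"
    then obtain j where i: "i = Suc j" by (cases i) auto
    show "periodic_quotients a0 xs i > 0"
      using pos \<open>l > 0\<close> by (simp add: i periodic_quotients_def l_def)
    show "x i > 0"
      using pos \<open>y > 0\<close> by (auto simp: i x_def intro!: prepend_pos dest: in_set_dropD)
  next
    fix i
    show "x i = of_int (periodic_quotients a0 xs i) + 1 / x (Suc i)"
    proof (cases i)
      case 0
      then show ?thesis by (simp add: x_def periodic_quotients_def fixp)
    next
      case (Suc j)
      have "j mod l < length xs" using \<open>l > 0\<close> by (simp add: l_def)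
      then have "x i = of_int (xs ! (j mod l)) + 1 / prepend (drop (Suc (j mod l)) xs) y"
        by (simp add: Suc x_def flip: Cons_nth_drop_Suc)
      moreover have "prepend (drop (Suc (j mod l)) xs) y = x (Suc i)"
        by (simp add: Suc x_def mod_Suc fixp) (simp add: l_def)
      ultimately show ?thesis
        by (simp add: Suc periodic_quotients_def l_def)
    qed
  qed
  then show ?thesis by (simp add: x_def)
qed

section \<open>The matrix powers\<close>

text \<open>
  One multiplication by \<open>((3, 1), (2, 1))\<close>: the two second-order recurrences become a coupled
  first-order one.
\<close>

lemma seqA_seqB_Suc:
  "seqA (Suc k) = 3 * seqA k + 2 * seqB k" "seqB (Suc k) = seqA k + seqB k"
proof -
  have "seqA (Suc k) = 3 * seqA k + 2 * seqB k \<and> seqB (Suc k) = seqA k + seqB k"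
    by (induction k) auto
  then show "seqA (Suc k) = 3 * seqA k + 2 * seqB k" "seqB (Suc k) = seqA k + seqB k"
    by simp_all
qed

lemma seqB_nonneg_seqA_gt: "seqB k \<ge> 0 \<and> seqA k > 2 * seqB k"
proof (induction k)
  case (Suc k)
  then show ?case unfolding seqA_seqB_Suc by auto
qed simp

text \<open>The determinant of the \<open>k\<close>-th matrix power.\<close>

lemma seqA_seqB_det: "seqA k * (seqA k - 2 * seqB k) - 2 * (seqB k)\<^sup>2 = 1"
proof (induction k)
  case (Suc k)
  then show ?case unfolding seqA_seqB_Suc by (simp add: algebra_simps power2_eq_square)
qed simp

lemma prepend_power_12:
  assumes "z > 0"
  shows "prepend (concat (replicate k [1, 2])) z
    = (of_int (seqA k) * z + of_int (seqB k)) /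
      (2 * of_int (seqB k) * z + of_int (seqA k - 2 * seqB k))"
proof (induction k)
  case 0
  then show ?case by simp
next
  case (Suc k)
  define A B where "A = real_of_int (seqA k)" and "B = real_of_int (seqB k)"
  have AB: "B \<ge> 0" "A > 2 * B"
    using seqB_nonneg_seqA_gt[of k] unfolding A_def B_def by linarith+
  have "A * z > 0" "B * z \<ge> 0" using AB assms by simp_all
  then have pos: "A * z + B > 0" "2 * B * z + (A - 2 * B) > 0" using AB by linarith+
  have step: "1 + 1 / (2 + 1 / (p / q)) = (3 * p + q) / (2 * p + q)"
    if "p > 0" "q > 0" for p q :: real
  proof -
    have "2 + 1 / (p / q) = (2 * p + q) / p" using that by (simp add: field_simps)
    then show ?thesis using that add_pos_pos[of "2 * p" q] by (simp add: field_simps)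
  qed
  have "prepend (concat (replicate (Suc k) [1, 2])) z
      = 1 + 1 / (2 + 1 / ((A * z + B) / (2 * B * z + (A - 2 * B))))"
    using Suc by (simp add: A_def B_def)
  also have "\<dots> = (3 * (A * z + B) + (2 * B * z + (A - 2 * B))) /
      (2 * (A * z + B) + (2 * B * z + (A - 2 * B)))"
    using pos by (rule step)
  also have "\<dots> = (of_int (seqA (Suc k)) * z + of_int (seqB (Suc k))) /
      (2 * of_int (seqB (Suc k)) * z + of_int (seqA (Suc k) - 2 * seqB (Suc k)))"
    unfolding seqA_seqB_Suc by (simp add: A_def B_def algebra_simps)
  finally show ?case .
qed

lemma prepend_power_21:
  assumes "z > 0"
  shows "prepend (concat (replicate k [2, 1])) z
    = (of_int (seqA k) * z + 2 * of_int (seqB k)) /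
      (of_int (seqB k) * z + of_int (seqA k - 2 * seqB k))"
proof (induction k)
  case 0
  then show ?case by simp
next
  case (Suc k)
  define A B where "A = real_of_int (seqA k)" and "B = real_of_int (seqB k)"
  have AB: "B \<ge> 0" "A > 2 * B"
    using seqB_nonneg_seqA_gt[of k] unfolding A_def B_def by linarith+
  have "A * z > 0" "B * z \<ge> 0" using AB assms by simp_all
  then have pos: "A * z + 2 * B > 0" "B * z + (A - 2 * B) > 0" using AB by linarith+
  have step: "2 + 1 / (1 + 1 / (p / q)) = (3 * p + 2 * q) / (p + q)"
    if "p > 0" "q > 0" for p q :: real
  proof -
    have "1 + 1 / (p / q) = (p + q) / p" using that by (simp add: field_simps)
    then show ?thesis using that add_pos_pos[of p q] by (simp add: field_simps)
  qed
  have "prepend (concat (replicate (Suc k) [2, 1])) z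
      = 2 + 1 / (1 + 1 / ((A * z + 2 * B) / (B * z + (A - 2 * B))))"
    using Suc by (simp add: A_def B_def)
  also have "\<dots> = (3 * (A * z + 2 * B) + 2 * (B * z + (A - 2 * B))) /
      (A * z + 2 * B + (B * z + (A - 2 * B)))"
    using pos by (rule step)
  also have "\<dots> = (of_int (seqA (Suc k)) * z + 2 * of_int (seqB (Suc k))) /
      (of_int (seqB (Suc k)) * z + of_int (seqA (Suc k) - 2 * seqB (Suc k)))"
    unfolding seqA_seqB_Suc by (simp add: A_def B_def algebra_simps)
  finally show ?case .
qed

section \<open>The square root\<close>

text \<open>
  The fixed point equation of the period in terms of \<open>z = x + a\<close>, for which \<open>1 / (x - a)\<close> is
  \<open>z / (4 B n + 2)\<close>. The numerator and the denominator of the composed Moebius transformation are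
  linear in \<open>z\<close>; after cross-multiplication, the quadratic equation of \<open>z\<close> removes \<open>z\<^sup>2\<close>, and the
  determinant the rest.
\<close>

lemma period_fixed_point_identity:
  fixes A B n a z :: real
  assumes det: "A * (A - 2 * B) - 2 * B\<^sup>2 = 1"
    and a: "a = A * n + 1"
    and z: "z\<^sup>2 = 2 * a * z + (4 * B * n + 2)"
    and V: "V = a * (A * z + 2 * B) + B * z + (A - 2 * B)"
    and W: "W = A * z + 2 * B"
  shows "(A * V + B * W) * (4 * B * n + 2) = z * (2 * B * V + (A - 2 * B) * W)"
  using assms by algebra

theorem theorem2:
  fixes k n :: nat
  assumes "k \<ge> 1" and "n \<ge> 1"
  shows "has_cfrac_value
           (periodic_quotients (seqA k * int n + 1)
             (concat (replicate k [1, 2]) @ [seqA k * int n + 1] @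
              concat (replicate k [2, 1]) @ [2 * (seqA k * int n + 1)]))
           (sqrt (of_int ((seqA k * int n + 1)\<^sup>2 + 2 * (2 * seqB k * int n + 1))))"
proof -
  define A B where "A = real_of_int (seqA k)" and "B = real_of_int (seqB k)"
  define a where "a = A * n + 1"
  define e where "e = 4 * B * n + 2"
  define x where "x = sqrt (a\<^sup>2 + e)"
  define z where "z = x + a"
  define y where "y = z / e"
  define xs where "xs = concat (replicate k [1, 2]) @ [seqA k * int n + 1] @
              concat (replicate k [2, 1]) @ [2 * (seqA k * int n + 1)]"
  have AB: "B \<ge> 0" "A > 2 * B"
    using seqB_nonneg_seqA_gt[of k] unfolding A_def B_def by linarith+
  have e: "e > 0" unfolding e_def using AB by (simp add: add_nonneg_pos)
  have a: "a > 0" unfolding a_def using AB by (simp add: add_nonneg_pos)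
  have "x\<^sup>2 = a\<^sup>2 + e" using e by (simp add: x_def)
  then have z2: "z\<^sup>2 = 2 * a * z + e" by (simp add: z_def power2_eq_square algebra_simps)
  have "x \<ge> 0" using e by (simp add: x_def)
  then have z: "z > 0" using a by (simp add: z_def)
  then have y: "y > 0" using e by (simp add: y_def)
  have inv_y: "1 / y = x - a"
  proof -
    have "(x - a) * z = e"
      using \<open>x\<^sup>2 = a\<^sup>2 + e\<close> by (simp add: z_def power2_eq_square algebra_simps)
    then show ?thesis using z by (simp add: y_def field_simps)
  qed
  have det: "A * (A - 2 * B) - 2 * B\<^sup>2 = 1"
    using arg_cong[OF seqA_seqB_det[of k], of real_of_int] by (simp add: A_def B_def)

  have "A * z > 0" "B * z \<ge> 0" using AB z by simp_all
  define W U where "W = A * z + 2 * B" and "U = B * z + (A - 2 * B)"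
  have WU: "W > 0" "U > 0"
    using \<open>A * z > 0\<close> \<open>B * z \<ge> 0\<close> AB unfolding W_def U_def by linarith+
  define V where "V = a * W + U"
  have V: "V > 0" using a WU by (simp add: V_def add_pos_pos)
  have "prepend xs y = prepend (concat (replicate k [1, 2])) (a + 1 / (W / U))"
  proof -
    have "prepend [2 * (seqA k * int n + 1)] y = z"
      by (simp add: inv_y z_def a_def A_def)
    then show ?thesis
      using z by (simp add: xs_def prepend_append prepend_power_21 W_def U_def A_def B_def a_def)
  qed
  also have "a + 1 / (W / U) = V / W"
    using WU by (simp add: V_def field_simps)
  also have "prepend (concat (replicate k [1, 2])) (V / W)
      = (A * (V / W) + B) / (2 * B * (V / W) + (A - 2 * B))"
    using V WU by (simp add: prepend_power_12 A_def B_def)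
  also have "\<dots> = (A * V + B * W) / (2 * B * V + (A - 2 * B) * W)"
  proof -
    have "A * (V / W) + B = (A * V + B * W) / W"
      "2 * B * (V / W) + (A - 2 * B) = (2 * B * V + (A - 2 * B) * W) / W"
      using WU by (simp_all add: field_simps)
    then show ?thesis using WU by simp
  qed
  also have "\<dots> = y"
  proof -
    have "2 * B * V + (A - 2 * B) * W > 0"
      using AB V WU by (intro add_nonneg_pos mult_nonneg_nonneg mult_pos_pos) auto
    moreover have "(A * V + B * W) * e = z * (2 * B * V + (A - 2 * B) * W)"
      using period_fixed_point_identity[OF det a_def, of z V W] z2
      by (simp add: e_def V_def W_def U_def)
    ultimately show ?thesis using e by (simp add: y_def divide_simps)
  qed
  finally have fixp: "prepend xs y = y" .

  have "seqA k > 0" using seqB_nonneg_seqA_gt[of k] by linarith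
  then have "seqA k * int n + 1 > 0" by (simp add: add_nonneg_pos)
  then have "\<forall>b\<in>set xs. b > 0" by (auto simp: xs_def)
  then have "has_cfrac_value (periodic_quotients (seqA k * int n + 1) xs)
      (of_int (seqA k * int n + 1) + 1 / y)"
    using y fixp by (intro has_cfrac_value_periodic) (auto simp: xs_def)
  moreover have "of_int (seqA k * int n + 1) + 1 / y
      = sqrt (of_int ((seqA k * int n + 1)\<^sup>2 + 2 * (2 * seqB k * int n + 1)))"
    by (simp add: inv_y x_def a_def e_def A_def B_def)
  ultimately show ?thesis by (simp add: xs_def)
qed

end
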